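(* Let $f_1, f_2:\mathbb{R}^n\to \mathbb{R}$ be directed subdifferentiable at $x\in \mathbb{R}^n$. Then $f= f_1\cdot f_2$ is also directed subdifferentiable at $x$ and $$\overrightarrow{\partial} f(x) = f_1(x)\, \overrightarrow{\partial} f_2(x) +f_2(x)\, \overrightarrow{\partial} f_1(x).$$ Moreover, if $f_2(x)\neq 0$, then $f= f_1/ f_2$ is also directed subdifferentiable at $x$ and $$\overrightarrow{\partial} f(x) = -\frac{1}{[f_2(x)]^2}\left[f_1(x)\,\overrightarrow{\partial} f_2(x)- f_2(x)\, \overrightarrow{\partial} f_1(x)\right].$$
   Context: Notation. $\mathcal{S}_{n-1}$ is the Euclidean unit sphere in $\mathbb{R}^n$ (so $\mathcal{S}_0=\{-1,1\}$). The (Dini) directional derivative of $f:\mathbb{R}^n\to\mathbb{R}$ at $x$ in direction $l$ is $f'(x;l)=\lim_{t\downarrow 0}\frac{f(x+tl)-f(x)}{t}$. (For the quotient, $f_1/f_2$ is considered where $f_2\ne0$; only its values at $x$ and at $x+tl$ with $t>0$ small depending on $l$ enter the definitions below.) For $n\ge 2$ and $l\in\mathcal{S}_{n-1}$, $\Pi_{n-1,l}:\mathbb{R}^n\to\mathbb{R}^{n-1}$ is a fixed linear map that maps the orthogonal complement of $l$ isometrically onto $\mathbb{R}^{n-1}$ and maps $l$ to $0$; its transpose $\Pi_{n-1,l}^\top:\mathbb{R}^{n-1}\to\mathbb{R}^n$ maps $\mathbb{R}^{n-1}$ onto the orthogonal complement of $l$ and inverts the restriction of $\Pi_{n-1,l}$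 to that complement. Directed subdifferentiable functions. A function $f:\mathbb{R}\to\mathbb{R}$ is $M$-directed subdifferentiable at $x\in\mathbb{R}$ if $f'(x;1)$ and $f'(x;-1)$ exist and $\max\{|f'(x;-1)|,|f'(x;1)|\}\le M$. A function $f:\mathbb{R}^n\to\mathbb{R}$, $n\ge2$, is $M$-directed subdifferentiable at $x\in\mathbb{R}^n$ if $f'(x;l)$ exists for every $l$, is continuous as a function of $l$, satisfies $\max_{l\in\mathcal{S}_{n-1}}|f'(x;l)|\le M$, and for every $l\in\mathcal{S}_{n-1}$ the function $f_l:\mathbb{R}^{n-1}\to\mathbb{R}$, $f_l(\cdot)=f'(x;l+\Pi_{n-1,l}^\top(\cdot))$, is $M$-directed subdifferentiable at $0_{n-1}$. $f$ is directed subdifferentiable at $x$ if it is $M$-directed subdifferentiable at $x$ for some $M\ge 0$. Directed sets. For $n=1$ a directed set is a directed interval $\overrightarrow{[a,b]}$ with $a,b\in\mathbb{R}$ arbitrary, identified with the pair $(a_1(-1),a_1(1))=(-a,b)$; its norm is $\max\{|a_1(-1)|,|a_1(1)|\}$. For $n\ge2$ a directed set is a family $\overrightarrow{A}=(\overrightarrow{A_{n-1}(l)},a_n(l))_{l\in\mathcal{S}_{n-1}}$ with $a_n:\mathcal{S}_{n-1}\to\mathbb{R}$ continuous and $l\mapsto\overrightarrow{A_{n-1}(l)}$ a map into $(n-1)$-dimensional directed sets, uniformly bounded in norm; its norm is $\max\{\sup_l\|\overrightarrow{A_{n-1}(l)}\|,\max_l|a_n(l)|\}$. Linear operations are componentwise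 and recursive: $\alpha\overrightarrow{[a,b]}+\beta\overrightarrow{[c,d]}=\overrightarrow{[\alpha a+\beta c,\alpha b+\beta d]}$ for all $\alpha,\beta\in\mathbb{R}$ and, for $n\ge2$, $\overrightarrow{A}+\overrightarrow{B}=(\overrightarrow{A_{n-1}(l)}+\overrightarrow{B_{n-1}(l)},a_n(l)+b_n(l))_{l}$, $\lambda\overrightarrow{A}=(\lambda\overrightarrow{A_{n-1}(l)},\lambda a_n(l))_{l}$ for $\lambda\in\mathbb{R}$, and $\overrightarrow{A}-\overrightarrow{B}=\overrightarrow{A}+(-1)\overrightarrow{B}$. Directed subdifferential. For $f$ directed subdifferentiable at $x$: if $n=1$, $\overrightarrow{\partial} f(x)=\overrightarrow{[-f'(x;-1),f'(x;1)]}=(f'(x;l))_{l=\pm1}$; if $n\ge2$, $\overrightarrow{\partial} f(x)=(\overrightarrow{\partial} f_l(0),f'(x;l))_{l\in\mathcal{S}_{n-1}}$ with $f_l(\cdot)=f'(x;l+\Pi_{n-1,l}^\top(\cdot))$. *)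

theory Defs
  imports "HOL-Analysis.Analysis"
begin

text \<open>
  The definitions are recursive in the dimension, so dimensions cannot be types. We use the
  library's \<^const>\<open>Euclidean_space\<close>, in which $\mathbb{R}^n$ is the set of sequences
  \<^typ>\<open>nat \<Rightarrow> real\<close> vanishing from index \<open>n\<close> on, and \<^const>\<open>nsphere\<close>, where
  \<^term>\<open>nsphere m\<close> is the unit sphere $\mathcal{S}_m$ of $\mathbb{R}^{m+1}$. A function
  $\mathbb{R}^n \to \mathbb{R}$ is a function \<^typ>\<open>(nat \<Rightarrow> real) \<Rightarrow> real\<close>; only its
  values on $\mathbb{R}^n$ are ever used.
\<close>

type_synonym rvec = "nat \<Rightarrow> real"

abbreviation rspace :: "nat \<Rightarrow> rvec set"
  where "rspace n \<equiv> topspace (Euclidean_space n)"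

abbreviation sphere_set :: "nat \<Rightarrow> rvec set"
  where "sphere_set m \<equiv> topspace (nsphere m)"

definition coord_vec :: "nat \<Rightarrow> real \<Rightarrow> rvec"
  where "coord_vec j a = (\<lambda>i. if i = j then a else 0)"

definition orth_compl :: "nat \<Rightarrow> rvec \<Rightarrow> rvec set"
  where "orth_compl n l = {v \<in> rspace n. (\<Sum>i<n. v i * l i) = 0}"

definition has_dir_deriv :: "(rvec \<Rightarrow> real) \<Rightarrow> rvec \<Rightarrow> rvec \<Rightarrow> real \<Rightarrow> bool"
  where "has_dir_deriv f x l D \<longleftrightarrow>
    ((\<lambda>t. (f (\<lambda>i. x i + t * l i) - f x) / t) \<longlongrightarrow> D) (at_right 0)"

definition dir_deriv_exists :: "(rvec \<Rightarrow> real) \<Rightarrow> rvec \<Rightarrow> rvec \<Rightarrow> bool"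
  where "dir_deriv_exists f x l \<longleftrightarrow> (\<exists>D. has_dir_deriv f x l D)"

definition dir_deriv :: "(rvec \<Rightarrow> real) \<Rightarrow> rvec \<Rightarrow> rvec \<Rightarrow> real"
  where "dir_deriv f x l = (THE D. has_dir_deriv f x l D)"

definition linear_between :: "nat \<Rightarrow> nat \<Rightarrow> (rvec \<Rightarrow> rvec) \<Rightarrow> bool"
  where "linear_between n m T \<longleftrightarrow>
    (\<forall>u \<in> rspace n. T u \<in> rspace m) \<and>
    (\<forall>u \<in> rspace n. \<forall>v \<in> rspace n. \<forall>a b.
       T (\<lambda>i. a * u i + b * v i) = (\<lambda>i. a * T u i + b * T v i))"

text \<open>
  The transpose $\mathbb{R}^m \to \mathbb{R}^n$ of a linear map
  $T : \mathbb{R}^n \to \mathbb{R}^m$, whose matrix has the entries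
  \<^term>\<open>T (coord_vec j 1) i\<close> (row \<open>i\<close>, column \<open>j\<close>).
\<close>
definition transpose_map :: "nat \<Rightarrow> nat \<Rightarrow> (rvec \<Rightarrow> rvec) \<Rightarrow> rvec \<Rightarrow> rvec"
  where "transpose_map n m T y =
    (\<lambda>j. if j < n then (\<Sum>i<m. T (coord_vec j 1) i * y i) else 0)"

text \<open>\<^term>\<open>P n l\<close> plays the role of $\Pi_{n-1,l}$.\<close>

definition projection_family :: "(nat \<Rightarrow> rvec \<Rightarrow> rvec \<Rightarrow> rvec) \<Rightarrow> bool"
  where "projection_family P \<longleftrightarrow>
    (\<forall>n \<ge> 2. \<forall>l \<in> sphere_set (n - 1).
       linear_between n (n - 1) (P n l) \<and>
       P n l l = (\<lambda>i. 0) \<and>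
       P n l ` orth_compl n l = rspace (n - 1) \<and>
       (\<forall>u \<in> orth_compl n l. \<forall>v \<in> orth_compl n l.
          L2_set (\<lambda>i. P n l u i - P n l v i) {..<n - 1} = L2_set (\<lambda>i. u i - v i) {..<n}))"

text \<open>The function $f_l$ on $\mathbb{R}^{n-1}$ attached to $f$ on $\mathbb{R}^n$ at \<open>x\<close>.\<close>

definition slice ::
    "(nat \<Rightarrow> rvec \<Rightarrow> rvec \<Rightarrow> rvec) \<Rightarrow> nat \<Rightarrow> (rvec \<Rightarrow> real) \<Rightarrow> rvec \<Rightarrow> rvec \<Rightarrow> rvec \<Rightarrow> real"
  where "slice P n f x l =
    (\<lambda>y. dir_deriv f x (\<lambda>j. l j + transpose_map n (n - 1) (P n l) y j))"

fun M_directed_subdifferentiable ::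
    "(nat \<Rightarrow> rvec \<Rightarrow> rvec \<Rightarrow> rvec) \<Rightarrow> real \<Rightarrow> nat \<Rightarrow> (rvec \<Rightarrow> real) \<Rightarrow> rvec \<Rightarrow> bool"
  where
    "M_directed_subdifferentiable P M 0 f x = False"
  | "M_directed_subdifferentiable P M (Suc 0) f x =
      (dir_deriv_exists f x (coord_vec 0 1) \<and> dir_deriv_exists f x (coord_vec 0 (-1)) \<and>
       max \<bar>dir_deriv f x (coord_vec 0 (-1))\<bar> \<bar>dir_deriv f x (coord_vec 0 1)\<bar> \<le> M)"
  | "M_directed_subdifferentiable P M (Suc (Suc m)) f x =
      ((\<forall>l \<in> rspace (Suc (Suc m)). dir_deriv_exists f x l) \<and>
       continuous_map (Euclidean_space (Suc (Suc m))) euclideanreal (dir_deriv f x) \<and>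
       (\<forall>l \<in> sphere_set (Suc m). \<bar>dir_deriv f x l\<bar> \<le> M) \<and>
       (\<forall>l \<in> sphere_set (Suc m).
          M_directed_subdifferentiable P M (Suc m) (slice P (Suc (Suc m)) f x l) (\<lambda>i. 0)))"

definition directed_subdifferentiable ::
    "(nat \<Rightarrow> rvec \<Rightarrow> rvec \<Rightarrow> rvec) \<Rightarrow> nat \<Rightarrow> (rvec \<Rightarrow> real) \<Rightarrow> rvec \<Rightarrow> bool"
  where "directed_subdifferentiable P n f x \<longleftrightarrow>
    (\<exists>M \<ge> 0. M_directed_subdifferentiable P M n f x)"

text \<open>
  \<open>Directed_Interval a b\<close> is the directed interval $\overrightarrow{[a,b]}$, that is, the pair
  $(a_1(-1), a_1(1)) = (-a, b)$. \<open>Directed_Family A a\<close> is the family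
  $(\overrightarrow{A_{n-1}(l)}, a_n(l))_l$; its components are functions on all of
  \<^typ>\<open>rvec\<close>, and to make HOL equality coincide with equality of families they are required
  to be \<^const>\<open>extensional\<close>, i.e. \<^const>\<open>undefined\<close> off the sphere $\mathcal{S}_{n-1}$.
\<close>

datatype dset =
    Directed_Interval real real
  | Directed_Family "rvec \<Rightarrow> dset" "rvec \<Rightarrow> real"

text \<open>
  In the functions below the first argument is the dimension; their values for arguments that are
  not directed sets of that dimension are irrelevant.
\<close>

fun directed_norm :: "nat \<Rightarrow> dset \<Rightarrow> real"
  where
    "directed_norm (Suc 0) (Directed_Interval a b) = max \<bar>-a\<bar> \<bar>b\<bar>"
  | "directed_norm (Suc (Suc m)) (Directed_Family A a) =
      max (SUP l \<in> sphere_set (Suc m). directed_norm (Suc m) (A l))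
          (SUP l \<in> sphere_set (Suc m). \<bar>a l\<bar>)"

fun directed_sets :: "nat \<Rightarrow> dset set"
  where
    "directed_sets 0 = {}"
  | "directed_sets (Suc 0) = {Directed_Interval a b | a b. True}"
  | "directed_sets (Suc (Suc m)) =
      {Directed_Family A a | A a.
         A \<in> extensional (sphere_set (Suc m)) \<and> a \<in> extensional (sphere_set (Suc m)) \<and>
         continuous_map (nsphere (Suc m)) euclideanreal a \<and>
         (\<forall>l \<in> sphere_set (Suc m). A l \<in> directed_sets (Suc m)) \<and>
         (\<exists>M. \<forall>l \<in> sphere_set (Suc m). directed_norm (Suc m) (A l) \<le> M)}"

fun directed_add :: "nat \<Rightarrow> dset \<Rightarrow> dset \<Rightarrow> dset"
  where
    "directed_add (Suc 0) (Directed_Interval a b) (Directed_Interval c d) =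
      Directed_Interval (a + c) (b + d)"
  | "directed_add (Suc (Suc m)) (Directed_Family A a) (Directed_Family B b) =
      Directed_Family (\<lambda>l \<in> sphere_set (Suc m). directed_add (Suc m) (A l) (B l))
                      (\<lambda>l \<in> sphere_set (Suc m). a l + b l)"

fun directed_scale :: "nat \<Rightarrow> real \<Rightarrow> dset \<Rightarrow> dset"
  where
    "directed_scale (Suc 0) c (Directed_Interval a b) = Directed_Interval (c * a) (c * b)"
  | "directed_scale (Suc (Suc m)) c (Directed_Family A a) =
      Directed_Family (\<lambda>l \<in> sphere_set (Suc m). directed_scale (Suc m) c (A l))
                      (\<lambda>l \<in> sphere_set (Suc m). c * a l)"

definition directed_diff :: "nat \<Rightarrow> dset \<Rightarrow> dset \<Rightarrow> dset"
  where "directed_diff n A B = directed_add n A (directed_scale n (-1) B)"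

fun directed_subdifferential ::
    "(nat \<Rightarrow> rvec \<Rightarrow> rvec \<Rightarrow> rvec) \<Rightarrow> nat \<Rightarrow> (rvec \<Rightarrow> real) \<Rightarrow> rvec \<Rightarrow> dset"
  where
    "directed_subdifferential P (Suc 0) f x =
      Directed_Interval (- dir_deriv f x (coord_vec 0 (-1))) (dir_deriv f x (coord_vec 0 1))"
  | "directed_subdifferential P (Suc (Suc m)) f x =
      Directed_Family
        (\<lambda>l \<in> sphere_set (Suc m).
           directed_subdifferential P (Suc m) (slice P (Suc (Suc m)) f x l) (\<lambda>i. 0))
        (\<lambda>l \<in> sphere_set (Suc m). dir_deriv f x l)"

lemma sphere_set_nonempty: "sphere_set m \<noteq> {}"
proof -
  have "coord_vec 0 1 \<in> sphere_set m"
    by (simp add: nsphere coord_vec_def if_distrib [of "\<lambda>x. x ^ 2"] cong: if_cong)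
  then show ?thesis by blast
qed

lemma directed_subdifferential_in_directed_sets:
  assumes "M_directed_subdifferentiable P M n f x"
  shows "directed_subdifferential P n f x \<in> directed_sets n \<and>
         directed_norm n (directed_subdifferential P n f x) \<le> M"
  using assms
proof (induction P M n f x rule: M_directed_subdifferentiable.induct)
  case (3 P M m f x)
  let ?S = "sphere_set (Suc m)"
  let ?A = "\<lambda>l. directed_subdifferential P (Suc m) (slice P (Suc (Suc m)) f x l) (\<lambda>i. 0)"
  have IH: "?A l \<in> directed_sets (Suc m) \<and> directed_norm (Suc m) (?A l) \<le> M" if "l \<in> ?S" for l
    using 3 that by simp
  have "continuous_map (nsphere (Suc m)) euclideanreal (dir_deriv f x)"
    using 3 by (simp add: nsphere_def continuous_map_from_subtopology)
  then have "continuous_map (nsphere (Suc m)) euclideanreal (restrict (dir_deriv f x) ?S)"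
    by (rule continuous_map_eq) simp
  moreover have "\<exists>M. \<forall>l\<in>?S. directed_norm (Suc m) (?A l) \<le> M"
    using IH by blast
  moreover have "(SUP l\<in>?S. directed_norm (Suc m) (?A l)) \<le> M"
    using IH sphere_set_nonempty by (intro cSUP_least) auto
  moreover have "(SUP l\<in>?S. \<bar>dir_deriv f x l\<bar>) \<le> M"
    using 3 sphere_set_nonempty by (intro cSUP_least) auto
  ultimately show ?case
    using IH by (auto cong: SUP_cong_simp)
qed auto

end

theory Submission
  imports Defs
begin

text \<open>
  Along a ray, the product and quotient rules express the directional derivative of
  $f_1 f_2$ and of $f_1/f_2$ at $x$ as a linear combination, with coefficients depending on $x$
  only, of those of $f_1$ and $f_2$. The slice $f_l$ is then the same linear combination of the
  slices of $f_1$ and $f_2$, so the combination is inherited by every lower dimension.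
\<close>

text \<open>Reduces to one real variable: at \<open>t = 0\<close> the ray passes through
  \<open>x\<close>, so the difference quotients coincide and the calculus rules for derivatives
  within \<open>at_right 0\<close> become available.\<close>

lemma has_dir_deriv_iff_DERIV:
  "has_dir_deriv f x l D \<longleftrightarrow>
     ((\<lambda>t. f (\<lambda>i. x i + t * l i)) has_field_derivative D) (at_right 0)"
  by (simp add: has_dir_deriv_def has_field_derivative_iff)

lemma has_dir_deriv_mult:
  assumes "has_dir_deriv f x l D" and "has_dir_deriv g x l E"
  shows "has_dir_deriv (\<lambda>y. f y * g y) x l (f x * E + g x * D)"
  using DERIV_mult [OF assms [unfolded has_dir_deriv_iff_DERIV]]
  by (simp add: has_dir_deriv_iff_DERIV algebra_simps)

text \<open>Nonvanishing at \<open>x\<close> suffices, since a one-sided derivative makes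
  \<open>g\<close> continuous along the ray. The coefficients are left uncancelled to match the
  factors in the claimed formula for the quotient.\<close>

lemma has_dir_deriv_divide:
  assumes "has_dir_deriv f x l D" and "has_dir_deriv g x l E" and "g x \<noteq> 0"
  shows "has_dir_deriv (\<lambda>y. f y / g y) x l (- (1 / (g x)\<^sup>2) * f x * E + 1 / (g x)\<^sup>2 * g x * D)"
proof -
  have "(D * g x - f x * E) / (g x * g x) =
      - (1 / (g x)\<^sup>2) * f x * E + 1 / (g x)\<^sup>2 * g x * D"
    using assms(3) by (simp add: field_simps power2_eq_square)
  then show ?thesis
    using DERIV_divide [OF assms(1,2) [unfolded has_dir_deriv_iff_DERIV]] assms(3)
    by (simp add: has_dir_deriv_iff_DERIV)
qed

lemma has_dir_deriv_linear_combination: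
  assumes "has_dir_deriv f x l D" and "has_dir_deriv g x l E"
  shows "has_dir_deriv (\<lambda>y. a * f y + b * g y) x l (a * D + b * E)"
  using assms unfolding has_dir_deriv_iff_DERIV
  by (intro DERIV_add DERIV_cmult)

lemma dir_deriv_eqI:
  assumes "has_dir_deriv f x l D"
  shows "dir_deriv f x l = D"
  unfolding dir_deriv_def using assms
  by (rule the_equality) (use assms in \<open>auto simp: has_dir_deriv_def intro: tendsto_unique [rotated]\<close>)

lemma has_dir_deriv_dir_deriv:
  "dir_deriv_exists f x l \<Longrightarrow> has_dir_deriv f x l (dir_deriv f x l)"
  by (auto simp: dir_deriv_exists_def dir_deriv_eqI)

lemma coord_vec_in_rspace: "j < n \<Longrightarrow> coord_vec j a \<in> rspace n"
  by (auto simp: coord_vec_def topspace_Euclidean_space)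

lemma sphere_set_subset_rspace: "sphere_set m \<subseteq> rspace (Suc m)"
  by (auto simp: nsphere_def)

lemma slice_direction_in_rspace:
  assumes "l \<in> rspace n"
  shows "(\<lambda>j. l j + transpose_map n m T y j) \<in> rspace n"
  using assms by (auto simp: topspace_Euclidean_space transpose_map_def)

lemma abs_linear_combination_le:
  fixes a b :: real
  assumes "\<bar>u\<bar> \<le> M" and "\<bar>v\<bar> \<le> N"
  shows "\<bar>a * u + b * v\<bar> \<le> \<bar>a\<bar> * M + \<bar>b\<bar> * N"
proof -
  have "\<bar>a * u + b * v\<bar> \<le> \<bar>a\<bar> * \<bar>u\<bar> + \<bar>b\<bar> * \<bar>v\<bar>"
    by (metis abs_mult abs_triangle_ineq)
  also have "\<dots> \<le> \<bar>a\<bar> * M + \<bar>b\<bar> * N"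
    using assms by (intro add_mono mult_left_mono) auto
  finally show ?thesis .
qed

text \<open>The assumption on \<open>h\<close> concerns only its directional derivatives at
  \<open>x\<close>, so \<open>h\<close> may be a product or a quotient at the top level and a
  genuine linear combination of slices below it. Since \<open>a\<close> and \<open>b\<close> stay
  fixed during the induction, one bound serves all dimensions.\<close>

lemma directed_subdifferential_linear_combination:
  assumes "M_directed_subdifferentiable P M n f x"
    and "M_directed_subdifferentiable P N n g x"
    and "\<And>l D E. l \<in> rspace n \<Longrightarrow> has_dir_deriv f x l D \<Longrightarrow> has_dir_deriv g x l E \<Longrightarrow>
           has_dir_deriv h x l (a * D + b * E)"
  shows "M_directed_subdifferentiable P (\<bar>a\<bar> * M + \<bar>b\<bar> * N) n h x \<and>
         directed_subdifferential P n h x =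
           directed_add n (directed_scale n a (directed_subdifferential P n f x))
                          (directed_scale n b (directed_subdifferential P n g x))"
  using assms
proof (induction n arbitrary: f g h x rule: induct_nat_012)
  case 0
  then show ?case by simp
next
  case 1
  have h: "has_dir_deriv h x (coord_vec 0 s)
             (a * dir_deriv f x (coord_vec 0 s) + b * dir_deriv g x (coord_vec 0 s))"
    if "s \<in> {1, -1}" for s
    using that 1 by (auto simp: coord_vec_in_rspace has_dir_deriv_dir_deriv)
  have "dir_deriv_exists h x (coord_vec 0 s)"
    "dir_deriv h x (coord_vec 0 s) =
       a * dir_deriv f x (coord_vec 0 s) + b * dir_deriv g x (coord_vec 0 s)"
    if "s \<in> {1, -1}" for s
    using h [OF that] by (auto simp: dir_deriv_exists_def dir_deriv_eqI)
  then show ?case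
    using 1(1,2) by (auto simp: abs_linear_combination_le)
next
  case (ge2 m)
  let ?n = "Suc (Suc m)"
  let ?S = "sphere_set (Suc m)"
  have h: "has_dir_deriv h x l (a * dir_deriv f x l + b * dir_deriv g x l)"
    if "l \<in> rspace ?n" for l
    using that ge2.prems(1,2) by (intro ge2.prems(3)) (auto simp: has_dir_deriv_dir_deriv)
  then have ex: "dir_deriv_exists h x l"
    and eq: "dir_deriv h x l = a * dir_deriv f x l + b * dir_deriv g x l"
    if "l \<in> rspace ?n" for l
    using that by (auto simp: dir_deriv_exists_def dir_deriv_eqI)
  have S: "l \<in> rspace ?n" if "l \<in> ?S" for l
    using that sphere_set_subset_rspace by blast
  have "continuous_map (Euclidean_space ?n) euclideanreal
          (\<lambda>l. a * dir_deriv f x l + b * dir_deriv g x l)"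
    using ge2.prems(1,2) by (intro continuous_intros) auto
  then have cont: "continuous_map (Euclidean_space ?n) euclideanreal (dir_deriv h x)"
    by (rule continuous_map_eq) (simp add: eq)
  have bound: "\<bar>dir_deriv h x l\<bar> \<le> \<bar>a\<bar> * M + \<bar>b\<bar> * N" if "l \<in> ?S" for l
    using that ge2.prems(1,2) by (simp add: eq S abs_linear_combination_le)
  \<comment> \<open>This is an equality of functions on all of \<open>rvec\<close>:
    \<open>transpose_map\<close> cuts its output off at \<open>?n\<close>, so for every
    \<open>y\<close> the direction lies in \<open>rspace ?n\<close>, where \<open>eq\<close>
    applies.\<close>
  have slice: "slice P ?n h x l =
      (\<lambda>y. a * slice P ?n f x l y + b * slice P ?n g x l y)" if "l \<in> ?S" for l
    by (simp add: slice_def eq slice_direction_in_rspace S that)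
  have "M_directed_subdifferentiable P (\<bar>a\<bar> * M + \<bar>b\<bar> * N) (Suc m) (slice P ?n h x l) (\<lambda>i. 0) \<and>
        directed_subdifferential P (Suc m) (slice P ?n h x l) (\<lambda>i. 0) =
          directed_add (Suc m)
            (directed_scale (Suc m) a (directed_subdifferential P (Suc m) (slice P ?n f x l) (\<lambda>i. 0)))
            (directed_scale (Suc m) b (directed_subdifferential P (Suc m) (slice P ?n g x l) (\<lambda>i. 0)))"
    if "l \<in> ?S" for l
  \<comment> \<open>The induction follows the recursion of the definitions, with hypotheses for
    \<open>m\<close> and \<open>Suc m\<close>; slices live in dimension
    \<open>Suc m\<close>.\<close>
  proof (rule ge2.IH(2))
    show "M_directed_subdifferentiable P M (Suc m) (slice P ?n f x l) (\<lambda>i. 0)"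
      "M_directed_subdifferentiable P N (Suc m) (slice P ?n g x l) (\<lambda>i. 0)"
      using ge2.prems(1,2) that by simp_all
  qed (simp add: slice [OF that] has_dir_deriv_linear_combination)
  with ex cont bound show ?case
    \<comment> \<open>Both components of the families are restricted to the sphere, so agreement
      there gives equality in \<open>dset\<close>.\<close>
    by (auto simp: eq S intro!: restrict_ext)
qed

text \<open>Brings the bracket of the quotient formula into the form of a sum of two multiples.
  Membership in \<open>directed_sets n\<close> fixes the constructor at each level, so that the
  recursive equations apply and the identity reduces to distributivity in each real entry.\<close>

lemma directed_scale_diff_scale:
  assumes "A \<in> directed_sets n" and "B \<in> directed_sets n"
  shows "directed_scale n c (directed_diff n (directed_scale n a A) (directed_scale n b B)) =
         directed_add n (directed_scale n (c * a) A) (directed_scale n (- (c * b)) B)"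
  using assms
proof (induction n arbitrary: A B rule: induct_nat_012)
  case (ge2 m)
  then show ?case
    by (auto simp: directed_diff_def algebra_simps intro!: restrict_ext)
qed (auto simp: directed_diff_def algebra_simps)

theorem proposition2p7:
  fixes P :: "nat \<Rightarrow> rvec \<Rightarrow> rvec \<Rightarrow> rvec"
    and n :: nat
    and f1 f2 :: "rvec \<Rightarrow> real"
    and x :: rvec
  assumes "projection_family P"
    and "n \<ge> 1"
    and "x \<in> rspace n"
    and "directed_subdifferentiable P n f1 x"
    and "directed_subdifferentiable P n f2 x"
  shows "directed_subdifferentiable P n (\<lambda>y. f1 y * f2 y) x \<and>
         directed_subdifferential P n (\<lambda>y. f1 y * f2 y) x =
           directed_add n
             (directed_scale n (f1 x) (directed_subdifferential P n f2 x))
             (directed_scale n (f2 x) (directed_subdifferential P n f1 x)) \<and>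
         (f2 x \<noteq> 0 \<longrightarrow>
           directed_subdifferentiable P n (\<lambda>y. f1 y / f2 y) x \<and>
           directed_subdifferential P n (\<lambda>y. f1 y / f2 y) x =
             directed_scale n (- (1 / (f2 x)\<^sup>2))
               (directed_diff n
                 (directed_scale n (f1 x) (directed_subdifferential P n f2 x))
                 (directed_scale n (f2 x) (directed_subdifferential P n f1 x))))"
proof -
  obtain M1 M2 where "M1 \<ge> 0" "M2 \<ge> 0"
    and f1: "M_directed_subdifferentiable P M1 n f1 x"
    and f2: "M_directed_subdifferentiable P M2 n f2 x"
    using assms unfolding directed_subdifferentiable_def by blast
  have nonneg: "0 \<le> \<bar>a\<bar> * M2 + \<bar>b\<bar> * M1" for a b
    using \<open>M1 \<ge> 0\<close> \<open>M2 \<ge> 0\<close> by simp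
  \<comment> \<open>\<open>f2\<close> comes first because its subdifferential, with coefficient
    \<open>f1 x\<close> up to a factor, is the first term in both formulas.\<close>
  note combination = directed_subdifferential_linear_combination [OF f2 f1]
  have "directed_subdifferentiable P n (\<lambda>y. f1 y * f2 y) x \<and>
        directed_subdifferential P n (\<lambda>y. f1 y * f2 y) x =
          directed_add n
            (directed_scale n (f1 x) (directed_subdifferential P n f2 x))
            (directed_scale n (f2 x) (directed_subdifferential P n f1 x))"
    using combination [OF has_dir_deriv_mult] nonneg
    unfolding directed_subdifferentiable_def by blast
  moreover have "directed_subdifferentiable P n (\<lambda>y. f1 y / f2 y) x \<and>
      directed_subdifferential P n (\<lambda>y. f1 y / f2 y) x =
        directed_scale n (- (1 / (f2 x)\<^sup>2))
          (directed_diff n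
            (directed_scale n (f1 x) (directed_subdifferential P n f2 x))
            (directed_scale n (f2 x) (directed_subdifferential P n f1 x)))"
    if "f2 x \<noteq> 0"
  proof -
    have "directed_subdifferential P n f1 x \<in> directed_sets n"
      "directed_subdifferential P n f2 x \<in> directed_sets n"
      using f1 f2 directed_subdifferential_in_directed_sets by blast+
    \<comment> \<open>Identifies the coefficient \<open>- (c * b)\<close> from
      \<open>directed_scale_diff_scale\<close>, with \<open>c = - (1 / (f2 x)\<^sup>2)\<close> and
      \<open>b = f2 x\<close>, with the one from the quotient rule.\<close>
    moreover have "- (- (1 / (f2 x)\<^sup>2) * f2 x) = 1 / (f2 x)\<^sup>2 * f2 x"
      by simp
    ultimately show ?thesis
      using combination [OF has_dir_deriv_divide [where f = f1 and g = f2, OF _ _ that]] nonneg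
      unfolding directed_subdifferentiable_def
      by (simp only: directed_scale_diff_scale) blast
  qed
  ultimately show ?thesis by blast
qed

end
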